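(* (Dual variable agreement) Let $\{\mu_i^k,\mathbf{G}_i^k\}$, $i\in V$, be generated by the algorithm CoBa-DD described in the context, with bounded initial values $\mu_i^0,\mathbf{G}_i^0$, and let $$\bar\mu^k=\frac1n\sum_{i\in V}\mu_i^k,\qquad \bar{\mathbf{G}}^k=\frac1n\sum_{i\in V}\mathbf{G}_i^k .$$ Suppose the convexity/compactness, existence and Slater assumptions hold and that $\mathbf{W}$ satisfies the consensus-matrix conditions (all stated in the context). Let $\beta_0\ge c_0$, with $c_0$ as in the context, let $M=L+Q$, let $\delta\ge 0$, and let $$p:=\frac{\nu^\delta\beta_0}{\beta_0+\alpha M}.$$ Then there exists a number of consensus iterations $\bar\varphi$ such that, if $\varphi\ge\bar\varphi+\delta$, then for all $k\ge 1$ the dual variables reach consensus as $$\|\mu_i^{k+1}-\bar\mu^{k+1}\|_2\le 2p^{k-1}\nu^\delta\beta_0+2p\,\alpha M\,\frac{1-p^{k-1}}{1-p},\qquad\forall i\in V,$$ $$\|\mathbf{G}_i^{k+1}-\bar{\mathbf{G}}^{k+1}\|_{\mathrm F}\le 2p^{k-1}\nu^\delta\beta_0+2p\,\alpha M\,\frac{1-p^{k-1}}{1-p},\qquad\forall i\in V.$$ Furthermore, one has $$\bar\varphi=\frac{\log(\beta_0)-\log\big(4n(1+d^2)(\beta_0+\alpha M)\big)}{\log(\nu)}.$$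
   Context: Problem. Let $V=\{1,\dots,n\}$ be the nodes of an undirected time-invariant communication graph, with $N_i$ the set of neighbours of node $i$. For $i\in V$ let $f_i,g_i:\mathbb{R}\to\mathbb{R}$ be convex and $X_i\subset\mathbb{R}$ convex and compact; $X=\prod_{i\in V}X_i$. Let $\mathbf{A}_0,\mathbf{A}_i$ ($i\in V$) be real symmetric $d\times d$ matrices. The problem is $$\min_{x_i\in X_i,\,i\in V} f(\mathbf{x}):=\sum_{i\in V}f_i(x_i)\quad\text{s.t.}\quad \sum_{i\in V}g_i(x_i)\le 0,\quad \mathbf{A}_0+\sum_{i\in V}\mathbf{A}_ix_i\succeq 0.$$ Existence assumption: the feasible set $F$ is nonempty, $f(\mathbf{x})>-\infty$ for all $\mathbf{x}\in F$, and $f(\mathbf{x})<\infty$ for some $\mathbf{x}\in F$. Slater assumption: there is $\bar{\mathbf{x}}\in X$ with $\sum_i g_i(\bar x_i)<0$ and $\mathbf{A}_0+\sum_i\mathbf{A}_i\bar x_i\succ0$. Dual. $\mathbb{S}^d_+$ is the cone of positive semidefinite $d\times d$ matrices. For $\mu\in\mathbb{R}_+$, $\mathbf{G}\in\mathbb{S}_+^d$, let $L_i(x_i,\mu,\mathbf{G})=f_i(x_i)+\mu g_i(x_i)-\mathrm{tr}[(\mathbf{A}_0/n+\mathbf{A}_ix_i)\mathbf{G}]$, $q_i(\mu,\mathbf{G})=\min_{x_i\in X_i}L_i(x_i,\mu,\mathbf{G})$, $q=\sum_{i\in V}q_i$. Let $L=\max_{i\in V}\max_{x_i\in X_i}|g_i(x_i)|$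 and $Q=\max_{i\in V}\max_{x_i\in X_i}\|-\mathbf{A}_0/n-\mathbf{A}_ix_i\|_{\mathrm F}$. Consensus-matrix conditions. $\mathbf{W}\in\mathbb{R}^{n\times n}$ satisfies $[\mathbf{W}]_{ij}=0$ if $j\notin N_i\cup\{i\}$, $\mathbf{W}=\mathbf{W}^{\mathsf T}$, $\mathbf{W}\mathbf{1}_n=\mathbf{1}_n$, and the spectral radius of $\mathbf{W}-\mathbf{1}_n\mathbf{1}_n^{\mathsf T}/n$ is at most $\nu$, where $\nu<1$ (and $\nu>0$). Algorithm CoBa-DD. Fix $\alpha>0$, a number $\varphi\in\mathbb{N}$ of consensus steps, a Slater vector $\bar{\mathbf{x}}$, some $\tilde\mu\ge0,\tilde{\mathbf{G}}\succeq0$, set $\gamma=\min\{-\sum_i g_i(\bar x_i),\ \lambda_{\min}(\mathbf{A}_0+\sum_i\mathbf{A}_i\bar x_i)\}$, choose $r\ge (f(\bar{\mathbf{x}})-q(\tilde\mu,\tilde{\mathbf{G}}))/\gamma$, $r>0$, and let $D_\mu=\{\mu\ge0:|\mu|\le (f(\bar{\mathbf{x}})-q(\tilde\mu,\tilde{\mathbf{G}}))/\gamma+r\}$, $D_{\mathbf{G}}=\{\mathbf{G}\succeq0:\|\mathbf{G}\|_{\mathrm F}\le (f(\bar{\mathbf{x}})-q(\tilde\mu,\tilde{\mathbf{G}}))/\gamma+r\}$. Start from $\mu_i^0\in\mathbb{R}_+$, $\mathbf{G}_i^0\in\mathbb{S}_+^d$. For $k\ge0$ pick $\tilde x_i^k\in\mathrm{argmin}_{x_i\in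 X_i}L_i(x_i,\mu_i^k,\mathbf{G}_i^k)$, and update, with $\mathsf{P}_D$ the Euclidean (Frobenius) projection onto $D$, $$\mu_i^{k+1}=\mathsf{P}_{D_\mu}\Big[\sum_{j\in V}[\mathbf{W}^\varphi]_{ij}(\mu_j^k+\alpha g_j(\tilde x_j^k))\Big],\quad \mathbf{G}_i^{k+1}=\mathsf{P}_{D_{\mathbf{G}}}\Big[\sum_{j\in V}[\mathbf{W}^\varphi]_{ij}\big(\mathbf{G}_j^k-\alpha(\mathbf{A}_0/n+\mathbf{A}_j\tilde x_j^k)\big)\Big].$$ For $k\ge1$ the recovered primal vector $\mathbf{x}^k$ has components $x_i^k=\frac1k\sum_{t=1}^k\tilde x_i^t$. Constant $c_0$. $c_0\ge0$ is a number such that for all $i\in V$ $$\Big\|\sum_{j\in V}[\mathbf{W}^\varphi-\mathbf{1}_n\mathbf{1}_n^{\mathsf T}/n]_{ij}(\mu_j^0+\alpha g_j(\tilde x_j^0))\Big\|_2+\Big\|\sum_{j\in V}[\mathbf{W}^\varphi-\mathbf{1}_n\mathbf{1}_n^{\mathsf T}/n]_{ij}\big(\mathbf{G}_j^0-\alpha(\mathbf{A}_0/n+\mathbf{A}_j\tilde x_j^0)\big)\Big\|_{\mathrm F}\le c_0.$$ It is understood that $\beta_0>0$ and $M>0$, so that the logarithms and $1/(1-p)$ are defined. *)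

theory Defs
  imports "HOL-Analysis.Analysis"
begin

section \<open>Matrices\<close>

text \<open>
  The node set is the finite type \<open>'n\<close>, so that \<open>n = CARD('n)\<close>, and \<open>d = CARD('d)\<close>.
  On \<open>real^'d^'d\<close> the type-class norm and inner product are those of Frobenius; hence
  \<open>norm\<close>, and \<open>closest_point\<close> as well, refer to the Frobenius norm on matrices.
\<close>

definition psd :: "real^'d^'d \<Rightarrow> bool" where
  "psd A \<longleftrightarrow> transpose A = A \<and> (\<forall>v. 0 \<le> v \<bullet> (A *v v))"

definition pd :: "real^'d^'d \<Rightarrow> bool" where
  "pd A \<longleftrightarrow> transpose A = A \<and> (\<forall>v. v \<noteq> 0 \<longrightarrow> 0 < v \<bullet> (A *v v))"

text \<open>Powers have to be introduced because \<open>A ^ m\<close> is the entrywise power on this type.\<close>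

primrec matpow :: "real^'n^'n \<Rightarrow> nat \<Rightarrow> real^'n^'n" where
  "matpow A 0 = mat 1"
| "matpow A (Suc m) = A ** matpow A m"

text \<open>
  The next two are a maximum and a minimum: a square matrix has finitely many eigenvalues, and at
  least one complex one. \<open>lambda_min\<close> is only meant for symmetric matrices, all of whose
  eigenvalues are real.
\<close>

definition spectral_radius :: "real^'n^'n \<Rightarrow> real" where
  "spectral_radius A =
     Sup {cmod z | z. \<exists>v::complex^'n. v \<noteq> 0 \<and> map_matrix complex_of_real A *v v = z *s v}"

definition lambda_min :: "real^'d^'d \<Rightarrow> real" where
  "lambda_min A = Inf {l. \<exists>v. v \<noteq> 0 \<and> A *v v = l *s v}"

definition avg_matrix :: "real^'n^'n" where
  "avg_matrix = (\<chi> i j. 1 / real CARD('n))"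


section \<open>The primal problem\<close>

definition problem_data ::
  "('n::finite \<Rightarrow> real \<Rightarrow> real) \<Rightarrow> ('n \<Rightarrow> real \<Rightarrow> real) \<Rightarrow> ('n \<Rightarrow> real set)
    \<Rightarrow> real^'d^'d \<Rightarrow> ('n \<Rightarrow> real^'d^'d) \<Rightarrow> bool" where
  "problem_data f g X A0 A \<longleftrightarrow>
     (\<forall>i. convex_on UNIV (f i) \<and> convex_on UNIV (g i) \<and> convex (X i) \<and> compact (X i))
     \<and> transpose A0 = A0 \<and> (\<forall>i. transpose (A i) = A i)"

definition objective :: "('n::finite \<Rightarrow> real \<Rightarrow> real) \<Rightarrow> real^'n \<Rightarrow> real" where
  "objective f x = (\<Sum>i\<in>UNIV. f i (x $ i))"

definition lmi :: "real^'d^'d \<Rightarrow> ('n::finite \<Rightarrow> real^'d^'d) \<Rightarrow> real^'n \<Rightarrow> real^'d^'d" where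
  "lmi A0 A x = A0 + (\<Sum>i\<in>UNIV. (x $ i) *\<^sub>R A i)"

definition feasible_set ::
  "('n::finite \<Rightarrow> real \<Rightarrow> real) \<Rightarrow> ('n \<Rightarrow> real set) \<Rightarrow> real^'d^'d \<Rightarrow> ('n \<Rightarrow> real^'d^'d)
    \<Rightarrow> (real^'n) set" where
  "feasible_set g X A0 A =
     {x. (\<forall>i. x $ i \<in> X i) \<and> (\<Sum>i\<in>UNIV. g i (x $ i)) \<le> 0 \<and> psd (lmi A0 A x)}"

text \<open>As \<open>f\<close> is real-valued, the last two conjuncts only record the customary form of the assumption.\<close>

definition existence_assumption ::
  "('n::finite \<Rightarrow> real \<Rightarrow> real) \<Rightarrow> ('n \<Rightarrow> real \<Rightarrow> real) \<Rightarrow> ('n \<Rightarrow> real set)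
    \<Rightarrow> real^'d^'d \<Rightarrow> ('n \<Rightarrow> real^'d^'d) \<Rightarrow> bool" where
  "existence_assumption f g X A0 A \<longleftrightarrow>
     feasible_set g X A0 A \<noteq> {}
     \<and> (\<forall>x\<in>feasible_set g X A0 A. - \<infinity> < ereal (objective f x))
     \<and> (\<exists>x\<in>feasible_set g X A0 A. ereal (objective f x) < \<infinity>)"

definition slater_vector ::
  "('n::finite \<Rightarrow> real \<Rightarrow> real) \<Rightarrow> ('n \<Rightarrow> real set) \<Rightarrow> real^'d^'d \<Rightarrow> ('n \<Rightarrow> real^'d^'d)
    \<Rightarrow> real^'n \<Rightarrow> bool" where
  "slater_vector g X A0 A x \<longleftrightarrow>
     (\<forall>i. x $ i \<in> X i) \<and> (\<Sum>i\<in>UNIV. g i (x $ i)) < 0 \<and> pd (lmi A0 A x)"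


section \<open>The dual function\<close>

definition local_lagrangian ::
  "('n::finite \<Rightarrow> real \<Rightarrow> real) \<Rightarrow> ('n \<Rightarrow> real \<Rightarrow> real) \<Rightarrow> real^'d^'d \<Rightarrow> ('n \<Rightarrow> real^'d^'d)
    \<Rightarrow> 'n \<Rightarrow> real \<Rightarrow> real \<Rightarrow> real^'d^'d \<Rightarrow> real" where
  "local_lagrangian f g A0 A i y \<mu> G =
     f i y + \<mu> * g i y - trace (((1 / real CARD('n)) *\<^sub>R A0 + y *\<^sub>R A i) ** G)"

text \<open>
  Below, infima and suprema over \<open>X i\<close> are attained: the functions are continuous and
  \<open>X i\<close> is compact and, under the assumptions above, nonempty.
\<close>

definition dual_function ::
  "('n::finite \<Rightarrow> real \<Rightarrow> real) \<Rightarrow> ('n \<Rightarrow> real \<Rightarrow> real) \<Rightarrow> ('n \<Rightarrow> real set)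
    \<Rightarrow> real^'d^'d \<Rightarrow> ('n \<Rightarrow> real^'d^'d) \<Rightarrow> real \<Rightarrow> real^'d^'d \<Rightarrow> real" where
  "dual_function f g X A0 A \<mu> G = (\<Sum>i\<in>UNIV. INF y\<in>X i. local_lagrangian f g A0 A i y \<mu> G)"

definition const_L :: "('n::finite \<Rightarrow> real \<Rightarrow> real) \<Rightarrow> ('n \<Rightarrow> real set) \<Rightarrow> real" where
  "const_L g X = Max (range (\<lambda>i. SUP y\<in>X i. \<bar>g i y\<bar>))"

definition const_Q ::
  "('n::finite \<Rightarrow> real set) \<Rightarrow> real^'d^'d \<Rightarrow> ('n \<Rightarrow> real^'d^'d) \<Rightarrow> real" where
  "const_Q X A0 A =
     Max (range (\<lambda>i. SUP y\<in>X i. norm (- ((1 / real CARD('n)) *\<^sub>R A0) - y *\<^sub>R A i)))"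


section \<open>Consensus\<close>

text \<open>\<open>N i\<close> is the set of neighbours of \<open>i\<close>; whether self-loops are present is immaterial.\<close>

definition undirected_graph :: "('n \<Rightarrow> 'n set) \<Rightarrow> bool" where
  "undirected_graph N \<longleftrightarrow> (\<forall>i j. j \<in> N i \<longleftrightarrow> i \<in> N j)"

definition consensus_matrix :: "('n::finite \<Rightarrow> 'n set) \<Rightarrow> real \<Rightarrow> real^'n^'n \<Rightarrow> bool" where
  "consensus_matrix N \<nu> W \<longleftrightarrow>
     (\<forall>i j. j \<notin> N i \<union> {i} \<longrightarrow> W $ i $ j = 0)
     \<and> transpose W = W
     \<and> W *v (\<chi> i. 1) = (\<chi> i. 1)
     \<and> spectral_radius (W - avg_matrix) \<le> \<nu>"


section \<open>The algorithm\<close>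

definition slater_gamma ::
  "('n::finite \<Rightarrow> real \<Rightarrow> real) \<Rightarrow> real^'d^'d \<Rightarrow> ('n \<Rightarrow> real^'d^'d) \<Rightarrow> real^'n \<Rightarrow> real" where
  "slater_gamma g A0 A xbar =
     min (- (\<Sum>i\<in>UNIV. g i (xbar $ i))) (lambda_min (lmi A0 A xbar))"

definition dual_radius ::
  "('n::finite \<Rightarrow> real \<Rightarrow> real) \<Rightarrow> ('n \<Rightarrow> real \<Rightarrow> real) \<Rightarrow> ('n \<Rightarrow> real set)
    \<Rightarrow> real^'d^'d \<Rightarrow> ('n \<Rightarrow> real^'d^'d) \<Rightarrow> real^'n \<Rightarrow> real \<Rightarrow> real^'d^'d \<Rightarrow> real" where
  "dual_radius f g X A0 A xbar \<mu>t Gt =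
     (objective f xbar - dual_function f g X A0 A \<mu>t Gt) / slater_gamma g A0 A xbar"

definition D_mu :: "real \<Rightarrow> real set" where
  "D_mu R = {\<mu>. 0 \<le> \<mu> \<and> \<bar>\<mu>\<bar> \<le> R}"

definition D_G :: "real \<Rightarrow> (real^'d^'d) set" where
  "D_G R = {G. psd G \<and> norm G \<le> R}"

text \<open>
  The quantities that are mixed by the consensus steps; \<open>xt k i\<close> is the local Lagrangian
  minimiser of node \<open>i\<close> at iteration \<open>k\<close>.
\<close>

definition mu_step ::
  "('n \<Rightarrow> real \<Rightarrow> real) \<Rightarrow> real \<Rightarrow> (nat \<Rightarrow> 'n \<Rightarrow> real) \<Rightarrow> (nat \<Rightarrow> 'n \<Rightarrow> real)
    \<Rightarrow> nat \<Rightarrow> 'n::finite \<Rightarrow> real" where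
  "mu_step g \<alpha> \<mu> xt k j = \<mu> k j + \<alpha> * g j (xt k j)"

definition G_step ::
  "real^'d^'d \<Rightarrow> ('n \<Rightarrow> real^'d^'d) \<Rightarrow> real \<Rightarrow> (nat \<Rightarrow> 'n \<Rightarrow> real^'d^'d) \<Rightarrow> (nat \<Rightarrow> 'n \<Rightarrow> real)
    \<Rightarrow> nat \<Rightarrow> 'n::finite \<Rightarrow> real^'d^'d" where
  "G_step A0 A \<alpha> G xt k j =
     G k j - \<alpha> *\<^sub>R ((1 / real CARD('n)) *\<^sub>R A0 + xt k j *\<^sub>R A j)"

text \<open>
  \<open>(\<mu>, G, xt)\<close> is a run with \<open>\<phi>\<close> consensus steps, Slater vector \<open>xbar\<close>, dual point
  \<open>(\<mu>t, Gt)\<close> and parameter \<open>r\<close>. It is a relation since minimisers need not be unique.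
\<close>

definition coba_dd ::
  "('n::finite \<Rightarrow> real \<Rightarrow> real) \<Rightarrow> ('n \<Rightarrow> real \<Rightarrow> real) \<Rightarrow> ('n \<Rightarrow> real set)
    \<Rightarrow> real^'d^'d \<Rightarrow> ('n \<Rightarrow> real^'d^'d) \<Rightarrow> real^'n^'n \<Rightarrow> real \<Rightarrow> nat
    \<Rightarrow> real^'n \<Rightarrow> real \<Rightarrow> real^'d^'d \<Rightarrow> real
    \<Rightarrow> (nat \<Rightarrow> 'n \<Rightarrow> real) \<Rightarrow> (nat \<Rightarrow> 'n \<Rightarrow> real^'d^'d) \<Rightarrow> (nat \<Rightarrow> 'n \<Rightarrow> real) \<Rightarrow> bool" where
  "coba_dd f g X A0 A W \<alpha> \<phi> xbar \<mu>t Gt r \<mu> G xt \<longleftrightarrow>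
     slater_vector g X A0 A xbar
     \<and> 0 \<le> \<mu>t \<and> psd Gt
     \<and> 0 < r \<and> dual_radius f g X A0 A xbar \<mu>t Gt \<le> r
     \<and> (\<forall>i. 0 \<le> \<mu> 0 i \<and> psd (G 0 i))
     \<and> (\<forall>k i. is_arg_min (\<lambda>y. local_lagrangian f g A0 A i y (\<mu> k i) (G k i)) (\<lambda>y. y \<in> X i) (xt k i))
     \<and> (\<forall>k i. \<mu> (Suc k) i =
          closest_point (D_mu (dual_radius f g X A0 A xbar \<mu>t Gt + r))
            (\<Sum>j\<in>UNIV. matpow W \<phi> $ i $ j * mu_step g \<alpha> \<mu> xt k j))
     \<and> (\<forall>k i. G (Suc k) i =
          closest_point (D_G (dual_radius f g X A0 A xbar \<mu>t Gt + r))
            (\<Sum>j\<in>UNIV. (matpow W \<phi> $ i $ j) *\<^sub>R G_step A0 A \<alpha> G xt k j))"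

definition initial_disagreement_bound ::
  "('n::finite \<Rightarrow> real \<Rightarrow> real) \<Rightarrow> real^'d^'d \<Rightarrow> ('n \<Rightarrow> real^'d^'d) \<Rightarrow> real^'n^'n \<Rightarrow> real \<Rightarrow> nat
    \<Rightarrow> (nat \<Rightarrow> 'n \<Rightarrow> real) \<Rightarrow> (nat \<Rightarrow> 'n \<Rightarrow> real^'d^'d) \<Rightarrow> (nat \<Rightarrow> 'n \<Rightarrow> real) \<Rightarrow> real \<Rightarrow> bool" where
  "initial_disagreement_bound g A0 A W \<alpha> \<phi> \<mu> G xt c0 \<longleftrightarrow>
     0 \<le> c0
     \<and> (\<forall>i. norm (\<Sum>j\<in>UNIV. (matpow W \<phi> - avg_matrix) $ i $ j * mu_step g \<alpha> \<mu> xt 0 j)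
           + norm (\<Sum>j\<in>UNIV. ((matpow W \<phi> - avg_matrix) $ i $ j) *\<^sub>R G_step A0 A \<alpha> G xt 0 j)
           \<le> c0)"

definition node_average :: "('n::finite \<Rightarrow> 'a::real_vector) \<Rightarrow> 'a" where
  "node_average u = (1 / real CARD('n)) *\<^sub>R (\<Sum>i\<in>UNIV. u i)"

end

theory Submission
  imports Defs
begin

text \<open>
  Let \<open>J\<close> be the averaging matrix. Before the projections, node \<open>i\<close> deviates at iteration \<open>k\<close>
  from the common average by \<open>(W\<^sup>\<phi> - J)\<close> applied to the mixed quantities. As the rows of
  \<open>W\<^sup>\<phi> - J\<close> sum to zero, the projection of the previous average may be subtracted from these
  quantities first; since projections are nonexpansive, the largest deviation \<open>e\<^sub>k\<close> satisfies
  \<open>e\<^sub>k\<^sub>+\<^sub>1 \<le> \<sigma> (e\<^sub>k + \<alpha> M)\<close>, where \<open>\<sigma>\<close> is the largest absolute row sum of \<open>W\<^sup>\<phi> - J\<close>. Symmetry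
  turns the spectral radius into an operator norm, so that \<open>\<sigma> \<le> n \<nu>\<^sup>\<phi> \<le> p\<close>.
\<close>

section \<open>Spectral radius of symmetric matrices\<close>

text \<open>Compare both sides at a component of \<open>v\<close> of largest modulus. The bound is
  crude, but it makes the set under the \<open>Sup\<close> in \<open>spectral_radius\<close> bounded
  above.\<close>

lemma cmod_eigenvalue_le:
  fixes C :: "complex^'n^'n"
  assumes "v \<noteq> 0" and "C *v v = z *s v"
  shows "cmod z \<le> (\<Sum>i\<in>UNIV. \<Sum>j\<in>UNIV. cmod (C $ i $ j))"
proof -
  have "Max (range (\<lambda>j. cmod (v $ j))) \<in> range (\<lambda>j. cmod (v $ j))"
    by (rule Max_in) auto
  then obtain i where "Max (range (\<lambda>j. cmod (v $ j))) = cmod (v $ i)"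
    by blast
  then have i: "cmod (v $ j) \<le> cmod (v $ i)" for j
    using Max_ge[of "range (\<lambda>j. cmod (v $ j))" "cmod (v $ j)"] by simp
  have pos: "cmod (v $ i) > 0"
  proof (rule ccontr)
    assume "\<not> cmod (v $ i) > 0"
    then have "v $ j = 0" for j
      using i[of j] by (smt (verit) norm_le_zero_iff)
    then show False
      using assms(1) by (simp add: vec_eq_iff)
  qed
  have "cmod z * cmod (v $ i) = cmod ((C *v v) $ i)"
    by (simp add: assms(2) norm_mult)
  also have "\<dots> \<le> (\<Sum>j\<in>UNIV. cmod (C $ i $ j) * cmod (v $ i))"
    unfolding matrix_vector_mult_def
    by (auto intro!: sum_norm_le mult_left_mono simp: norm_mult i)
  also have "\<dots> = (\<Sum>j\<in>UNIV. cmod (C $ i $ j)) * cmod (v $ i)"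
    by (simp add: sum_distrib_right)
  finally have "cmod z \<le> (\<Sum>j\<in>UNIV. cmod (C $ i $ j))"
    using pos by simp
  also have "\<dots> \<le> (\<Sum>i\<in>UNIV. \<Sum>j\<in>UNIV. cmod (C $ i $ j))"
    by (rule member_le_sum) (auto intro: sum_nonneg)
  finally show ?thesis .
qed

text \<open>A real eigenvector, read as a complex vector, is an eigenvector of the complexified
  matrix.\<close>

lemma abs_eigenvalue_le_spectral_radius:
  fixes B :: "real^'n^'n"
  assumes "v \<noteq> 0" and "B *v v = l *s v"
  shows "\<bar>l\<bar> \<le> spectral_radius B"
proof -
  let ?S = "{cmod z | z. \<exists>v::complex^'n. v \<noteq> 0 \<and> map_matrix complex_of_real B *v v = z *s v}"
  let ?v = "(\<chi> i. complex_of_real (v $ i)) :: complex^'n"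
  have "?v \<noteq> 0"
    using assms(1) by (auto simp: vec_eq_iff)
  moreover have "map_matrix complex_of_real B *v ?v = complex_of_real l *s ?v"
  proof -
    have "(\<Sum>j\<in>UNIV. B $ i $ j * v $ j) = l * v $ i" for i
      using assms(2) by (simp add: vec_eq_iff matrix_vector_mult_def)
    then show ?thesis
      by (simp add: vec_eq_iff matrix_vector_mult_def map_matrix_def
            flip: of_real_mult of_real_sum)
  qed
  ultimately have "cmod (complex_of_real l) \<in> ?S"
    by blast
  moreover have "bdd_above ?S"
    using cmod_eigenvalue_le[of _ "map_matrix complex_of_real B"] by (intro bdd_aboveI) blast
  ultimately have "cmod (complex_of_real l) \<le> spectral_radius B"
    unfolding spectral_radius_def by (rule cSup_upper)
  then show ?thesis
    by simp
qed

text \<open>The maximum \<open>m\<close> of \<open>norm (B *v v)\<close> on the unit sphere is the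
  operator norm of \<open>B\<close>, and a maximiser shows that \<open>m\<close> or
  \<open>- m\<close> is an eigenvalue.\<close>

lemma symmetric_norm_le_spectral_radius:
  fixes B :: "real^'n^'n"
  assumes sym: "transpose B = B"
  shows "norm (B *v x) \<le> spectral_radius B * norm x"
proof -
  have "continuous_on (sphere 0 1) (\<lambda>v. norm (B *v v))"
    by (intro continuous_intros linear_continuous_on matrix_vector_mul_bounded_linear)
  moreover have "axis undefined 1 \<in> sphere (0::real^'n) 1"
    by simp
  ultimately obtain v where v: "norm v = 1"
    and vmax: "\<And>u. norm u = 1 \<Longrightarrow> norm (B *v u) \<le> norm (B *v v)"
    using continuous_attains_sup[OF compact_sphere, of 0 1 "\<lambda>v. norm (B *v v)"] by auto
  define m where "m = norm (B *v v)"
  have bound: "norm (B *v u) \<le> m * norm u" for u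
  proof (cases "u = 0")
    case False
    then have "norm (B *v ((1 / norm u) *\<^sub>R u)) \<le> m"
      unfolding m_def by (intro vmax) simp
    then show ?thesis
      using False by (simp add: matrix_vector_mult_scaleR field_simps)
  qed simp
  \<comment> \<open>Equality in the Cauchy-Schwarz inequality for \<open>\<langle>B\<^sup>2 v, v\<rangle> = m\<^sup>2\<close>.\<close>
  have sq: "B *v (B *v v) = m\<^sup>2 *\<^sub>R v"
  proof -
    have vv: "v \<bullet> v = 1"
      using v by (simp add: dot_square_norm)
    have inner: "(B *v (B *v v)) \<bullet> v = m\<^sup>2"
      using dot_lmul_matrix[of "B *v v" B v] sym
      by (simp add: m_def dot_square_norm flip: transpose_matrix_vector)
    have "norm (B *v (B *v v)) \<le> m\<^sup>2"
      using bound[of "B *v v"] by (simp add: m_def power2_eq_square)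
    then have "(norm (B *v (B *v v)))\<^sup>2 \<le> (m\<^sup>2)\<^sup>2"
      by (intro power_mono) auto
    then have "(B *v (B *v v)) \<bullet> (B *v (B *v v)) \<le> (m\<^sup>2)\<^sup>2"
      by (simp add: dot_square_norm)
    \<comment> \<open>Expanding the square gives at most m^4 - 2 m^2 m^2 + m^4 = 0.\<close>
    then have "(B *v (B *v v) - m\<^sup>2 *\<^sub>R v) \<bullet> (B *v (B *v v) - m\<^sup>2 *\<^sub>R v) \<le> 0"
      using inner vv
      by (simp add: inner_diff_left inner_diff_right inner_commute power2_eq_square)
    then show ?thesis
      by (metis eq_iff_diff_eq_0 inner_ge_zero order_antisym inner_eq_zero_iff)
  qed
  \<comment> \<open>Hence \<open>(B - m) (B + m) v = 0\<close>, and \<open>m\<close> or \<open>- m\<close> is an eigenvalue.\<close>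
  have "m \<le> spectral_radius B"
  proof (cases "B *v v + m *\<^sub>R v = 0")
    case True
    then have "B *v v = (- m) *s v"
      by (simp add: scalar_mult_eq_scaleR add_eq_0_iff)
    moreover have "v \<noteq> 0"
      using v by auto
    ultimately show ?thesis
      using abs_eigenvalue_le_spectral_radius[of v B "- m"] by auto
  next
    case False
    have "B *v (B *v v + m *\<^sub>R v) = m *s (B *v v + m *\<^sub>R v)"
      by (simp add: matrix_vector_right_distrib matrix_vector_mult_scaleR sq
            scalar_mult_eq_scaleR scaleR_add_right power2_eq_square)
    then show ?thesis
      using abs_eigenvalue_le_spectral_radius[OF False] by fastforce
  qed
  then show ?thesis
    using bound[of x] by (meson mult_right_mono norm_ge_zero order_trans)
qed

section \<open>Consensus matrices\<close>

lemma norm_matpow_le: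
  assumes "\<And>x. norm (B *v x) \<le> c * norm x" and "0 \<le> c"
  shows "norm (matpow B m *v x) \<le> c ^ m * norm x"
proof (induction m)
  case (Suc m)
  have "norm (matpow B (Suc m) *v x) \<le> c * norm (matpow B m *v x)"
    using assms(1) by (simp flip: matrix_vector_mul_assoc)
  also have "\<dots> \<le> c * (c ^ m * norm x)"
    using Suc assms(2) by (rule mult_left_mono)
  finally show ?case
    by (simp add: mult.assoc)
qed simp

lemma matpow_fixed_vector:
  assumes "W *v x = x"
  shows "matpow W m *v x = x"
  by (induction m) (simp_all add: assms flip: matrix_vector_mul_assoc)

lemma row_sum_eq_1:
  fixes C :: "real^'n^'n"
  assumes "C *v (\<chi> i. 1) = (\<chi> i. 1)"
  shows "(\<Sum>j\<in>UNIV. C $ i $ j) = 1"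
  using assms by (simp add: vec_eq_iff matrix_vector_mult_def)

lemma avg_matrix_mult:
  fixes C :: "real^'n^'n"
  assumes "transpose C *v (\<chi> i. 1) = (\<chi> i. 1)"
  shows "avg_matrix ** C = avg_matrix"
  using row_sum_eq_1[OF assms]
  by (simp add: vec_eq_iff matrix_matrix_mult_def avg_matrix_def transpose_def
        flip: sum_divide_distrib)

lemma mult_avg_matrix:
  fixes C :: "real^'n^'n"
  assumes "C *v (\<chi> i. 1) = (\<chi> i. 1)"
  shows "C ** avg_matrix = avg_matrix"
  using row_sum_eq_1[OF assms]
  by (simp add: vec_eq_iff matrix_matrix_mult_def avg_matrix_def
        flip: sum_divide_distrib)

lemma transpose_avg_matrix: "transpose avg_matrix = avg_matrix"
  by (simp add: avg_matrix_def transpose_def)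

lemma avg_matrix_fixes_ones: "avg_matrix *v (\<chi> i. 1) = (\<chi> i. 1)"
  by (simp add: avg_matrix_def vec_eq_iff matrix_vector_mult_def)

lemma matrix_mult_diff_right:
  fixes P :: "'a::ring_1^'n^'m"
  shows "P ** (Q - R) = P ** Q - P ** R"
  by (simp add: vec_eq_iff matrix_matrix_mult_def right_diff_distrib sum_subtractf)

lemma matrix_mult_diff_left:
  fixes P :: "'a::ring_1^'n^'m"
  shows "(P - Q) ** R = P ** R - Q ** R"
  by (simp add: vec_eq_iff matrix_matrix_mult_def left_diff_distrib sum_subtractf)

text \<open>With J the averaging matrix, JW = WJ = JJ = J, so (W - J)(W^m - J) collapses to W^(m+1)
  - J. The exponent is a successor because the zeroth power of W - J is the identity, not the
  identity minus J.\<close>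

lemma matpow_diff_avg_matrix:
  fixes W :: "real^'n^'n"
  assumes sym: "transpose W = W" and ones: "W *v (\<chi> i. 1) = (\<chi> i. 1)"
  shows "matpow (W - avg_matrix) (Suc m) = matpow W (Suc m) - avg_matrix"
proof (induction m)
  case (Suc m)
  have JW: "avg_matrix ** W = avg_matrix"
    using avg_matrix_mult[of W] sym ones by simp
  have JWm: "avg_matrix ** matpow W k = avg_matrix" for k
    by (induction k) (simp_all add: matrix_mul_assoc JW)
  have JJ: "avg_matrix ** avg_matrix = (avg_matrix :: real^'n^'n)"
    by (rule mult_avg_matrix[OF avg_matrix_fixes_ones])
  have "matpow (W - avg_matrix) (Suc (Suc m))
      = (W - avg_matrix) ** (matpow W (Suc m) - avg_matrix)"
    using Suc by simp
  also have "\<dots> = matpow W (Suc (Suc m)) - avg_matrix"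
    using JWm[of "Suc m"] mult_avg_matrix[OF ones] JJ
    by (simp add: matrix_mult_diff_left matrix_mult_diff_right)
  finally show ?case .
qed simp

text \<open>Each entry is a coordinate of the power of \<open>W - avg_matrix\<close> applied to a
  basis vector, hence at most \<open>\<nu> ^ \<phi>\<close> in absolute value; a row has
  \<open>CARD('n)\<close> entries.\<close>

lemma consensus_row_sum_le:
  fixes W :: "real^'n^'n"
  assumes cm: "consensus_matrix N \<nu> W" and "0 \<le> \<nu>" and "0 < \<phi>"
  shows "(\<Sum>j\<in>UNIV. \<bar>(matpow W \<phi> - avg_matrix) $ i $ j\<bar>) \<le> real CARD('n) * \<nu> ^ \<phi>"
proof -
  let ?B = "W - avg_matrix"
  have sym: "transpose W = W" and ones: "W *v (\<chi> i. 1) = (\<chi> i. 1)"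
    and rad: "spectral_radius ?B \<le> \<nu>"
    using cm by (auto simp: consensus_matrix_def)
  have "transpose ?B = ?B"
    using sym transpose_avg_matrix by (metis (no_types, lifting) transpose_def vec_eq_iff
      vec_lambda_beta vector_minus_component)
  then have "norm (?B *v x) \<le> \<nu> * norm x" for x
    by (meson symmetric_norm_le_spectral_radius rad mult_right_mono norm_ge_zero order_trans)
  then have *: "norm (matpow ?B \<phi> *v x) \<le> \<nu> ^ \<phi> * norm x" for x
    using \<open>0 \<le> \<nu>\<close> by (rule norm_matpow_le)
  have "\<bar>(matpow W \<phi> - avg_matrix) $ i $ j\<bar> \<le> \<nu> ^ \<phi>" for j
  proof -
    have "\<bar>(matpow ?B \<phi> *v axis j 1) $ i\<bar> \<le> \<nu> ^ \<phi>"
      using component_le_norm_cart[of "matpow ?B \<phi> *v axis j 1" i] *[of "axis j 1"] by simp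
    moreover have "matpow ?B \<phi> = matpow W \<phi> - avg_matrix"
      using matpow_diff_avg_matrix[OF sym ones, of "\<phi> - 1"] \<open>0 < \<phi>\<close> by simp
    ultimately show ?thesis
      by (simp add: matrix_vector_mul_component inner_axis column_def matrix_vector_mult_basis)
  qed
  then have "(\<Sum>j\<in>UNIV. \<bar>(matpow W \<phi> - avg_matrix) $ i $ j\<bar>) \<le> (\<Sum>j\<in>(UNIV::'n set). \<nu> ^ \<phi>)"
    by (rule sum_mono)
  then show ?thesis
    by simp
qed

section \<open>Projected consensus iterations\<close>

text \<open>
  The set may be empty: \<open>closest_point {}\<close> is a constant function. Thus the dual radius need not be
  shown to be nonnegative.
\<close>

lemma dist_closest_point_le:
  fixes S :: "'a::euclidean_space set"
  assumes "convex S" and "closed S"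
  shows "dist (closest_point S x) (closest_point S y) \<le> dist x y"
proof (cases "S = {}")
  case True
  then show ?thesis
    by (simp add: closest_point_def)
qed (rule closest_point_lipschitz[OF assms])

text \<open>The average is as close to \<open>w\<close> as the points are, so the triangle
  inequality through \<open>w\<close> costs a factor 2. This is the 2 in the final bounds.\<close>

lemma norm_diff_node_average_le:
  fixes u :: "'n::finite \<Rightarrow> 'a::real_normed_vector"
  assumes "\<And>i. norm (u i - w) \<le> e"
  shows "norm (u i - node_average u) \<le> 2 * e"
proof -
  have "node_average u - w = (1 / real CARD('n)) *\<^sub>R (\<Sum>j\<in>UNIV. u j - w)"
    by (simp add: node_average_def sum_subtractf scaleR_diff_right sum_constant_scaleR)
  moreover have "norm (\<Sum>j\<in>UNIV. u j - w) \<le> real CARD('n) * e"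
    using sum_norm_bound[of UNIV "\<lambda>j. u j - w" e] assms by simp
  ultimately have "norm (node_average u - w) \<le> e"
    by (simp add: field_simps)
  then show ?thesis
    using assms[of i] norm_triangle_ineq4[of "u i - w" "node_average u - w"] by simp
qed

text \<open>A general Euclidean space covers the scalar and the matrix multipliers at once. The
  number \<open>\<theta>\<close> is what one step of the recursion makes of the initial bound
  \<open>\<beta>\<close>.\<close>

lemma projected_consensus_agreement:
  fixes u s :: "nat \<Rightarrow> 'n::finite \<Rightarrow> 'a::euclidean_space" and C :: "real^'n^'n"
  assumes S: "convex S" "closed S"
    and ones: "C *v (\<chi> i. 1) = (\<chi> i. 1)"
    and rows: "\<And>i. (\<Sum>j\<in>UNIV. \<bar>(C - avg_matrix) $ i $ j\<bar>) \<le> p"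
    and upd: "\<And>k i. u (Suc k) i = closest_point S (\<Sum>j\<in>UNIV. (C $ i $ j) *\<^sub>R s k j)"
    and step: "\<And>k j. norm (s k j - u k j) \<le> b"
    and init: "\<And>i. norm (\<Sum>j\<in>UNIV. ((C - avg_matrix) $ i $ j) *\<^sub>R s 0 j) \<le> \<beta>"
    and "p < 1" and start: "p * (\<beta> + b) = \<theta>" and "1 \<le> k"
  shows "norm (u (Suc k) i - node_average (u (Suc k)))
    \<le> 2 * (p ^ (k - 1) * \<theta> + p * b * ((1 - p ^ (k - 1)) / (1 - p)))"
proof -
  define dev where "dev k i = (\<Sum>j\<in>UNIV. ((C - avg_matrix) $ i $ j) *\<^sub>R s k j)" for k i
  have dev: "(\<Sum>j\<in>UNIV. (C $ i $ j) *\<^sub>R s k j) - node_average (s k) = dev k i" for k i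
    by (simp add: dev_def node_average_def avg_matrix_def scaleR_diff_left sum_subtractf
          scaleR_sum_right)
  have near: "norm (u (Suc k) i - closest_point S (node_average (s k))) \<le> norm (dev k i)" for k i
    using dist_closest_point_le[OF S, of "\<Sum>j\<in>UNIV. (C $ i $ j) *\<^sub>R s k j" "node_average (s k)"]
    by (simp add: upd dist_norm dev)
  have dev_Suc: "norm (dev (Suc k) i) \<le> p * (e + b)" if e: "\<And>i. norm (dev k i) \<le> e" for k i e
  proof -
    \<comment> \<open>This point is common to all nodes, so the zero row sums allow it to be
      subtracted from every \<open>s (Suc k) j\<close>. The distance to it splits into
      \<open>b\<close> for the step and \<open>e\<close> for the projected disagreement.\<close>
    define c where "c = closest_point S (node_average (s k))"
    have "0 \<le> e"
      using e norm_ge_zero order_trans by blast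
    have "0 \<le> b"
      using step norm_ge_zero order_trans by blast
    have zero: "(\<Sum>j\<in>UNIV. (C - avg_matrix) $ i $ j) = 0"
      using row_sum_eq_1[OF ones] row_sum_eq_1[OF avg_matrix_fixes_ones]
      by (simp add: sum_subtractf)
    have close: "norm (s (Suc k) j - c) \<le> e + b" for j
      using step[of "Suc k" j] near[of k j] e[of j]
        norm_triangle_ineq[of "s (Suc k) j - u (Suc k) j" "u (Suc k) j - c"]
      by (simp add: c_def)
    have "dev (Suc k) i = (\<Sum>j\<in>UNIV. ((C - avg_matrix) $ i $ j) *\<^sub>R (s (Suc k) j - c))"
      using zero unfolding dev_def
      by (simp only: scaleR_diff_right sum_subtractf flip: scaleR_sum_left) simp
    also have "norm \<dots> \<le> (\<Sum>j\<in>UNIV. \<bar>(C - avg_matrix) $ i $ j\<bar> * (e + b))"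
      by (rule sum_norm_le) (auto intro!: mult_left_mono close)
    also have "\<dots> \<le> p * (e + b)"
      using rows[of i] \<open>0 \<le> e\<close> \<open>0 \<le> b\<close>
      by (simp add: mult_right_mono flip: sum_distrib_right)
    finally show ?thesis .
  qed
  \<comment> \<open>Unrolls the recursion from e to p (e + b), starting with \<open>\<theta>\<close>
    for \<open>dev 1\<close>; the last term is the geometric sum p b + ... + p^m b.\<close>
  have "norm (dev (Suc m) i) \<le> p ^ m * \<theta> + p * b * ((1 - p ^ m) / (1 - p))" for m i
  proof (induction m arbitrary: i)
    case 0
    show ?case
      using dev_Suc[of 0 \<beta> i] init start by (simp add: dev_def)
  next
    case (Suc m)
    have "norm (dev (Suc (Suc m)) i) \<le> p * (p ^ m * \<theta> + p * b * ((1 - p ^ m) / (1 - p)) + b)"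
      by (rule dev_Suc) (rule Suc)
    also have "\<dots> = p ^ Suc m * \<theta> + p * b * ((1 - p ^ Suc m) / (1 - p))"
      using \<open>p < 1\<close> by (simp add: field_simps)
    finally show ?case .
  qed
  \<comment> \<open>\<open>u (Suc k)\<close> is controlled by \<open>dev k\<close>, whose bound has
    exponent \<open>k - 1\<close>; this is the index shift in the conclusion.\<close>
  from this[of "k - 1"] \<open>1 \<le> k\<close>
  have "norm (dev k i) \<le> p ^ (k - 1) * \<theta> + p * b * ((1 - p ^ (k - 1)) / (1 - p))" for i
    by simp
  with near show ?thesis
    by (intro norm_diff_node_average_le) (rule order_trans)
qed

section \<open>The algorithm\<close>

lemma D_mu_eq: "D_mu R = {0..R}"
  by (auto simp: D_mu_def)

text \<open>Conditions linear in \<open>G\<close>, intersected with a ball: convexity and closedness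
  can be checked one condition at a time.\<close>

lemma D_G_eq:
  "D_G R = (\<Inter>i. \<Inter>j. {G. G $ i $ j = G $ j $ i}) \<inter> (\<Inter>v. {G. 0 \<le> v \<bullet> (G *v v)}) \<inter> cball 0 R"
  by (auto simp: D_G_def psd_def vec_eq_iff transpose_def)

lemma convex_D_G: "convex (D_G R)"
  unfolding D_G_eq
proof (intro convex_Int convex_INT convex_cball)
  show "convex {G::real^'d^'d. G $ i $ j = G $ j $ i}" for i j
    by (auto simp: convex_def)
  show "convex {G::real^'d^'d. 0 \<le> v \<bullet> (G *v v)}" for v
    by (auto simp: convex_def matrix_vector_mult_add_rdistrib inner_add_right
          scaleR_matrix_vector_assoc[symmetric])
qed

lemma closed_D_G: "closed (D_G R)"
  unfolding D_G_eq matrix_vector_mult_def inner_vec_def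
  by (intro closed_Int closed_INT ballI closed_cball closed_Collect_eq closed_Collect_le
      continuous_intros)

section \<open>Uniform bounds on the step directions\<close>

lemma le_Max_SUP:
  fixes h :: "'n::finite \<Rightarrow> 'a::topological_space \<Rightarrow> real"
  assumes "compact (X i)" and "continuous_on (X i) (h i)" and "y \<in> X i"
  shows "h i y \<le> Max (range (\<lambda>i. SUP y\<in>X i. h i y))"
proof -
  have "h i y \<le> (SUP y\<in>X i. h i y)"
    using assms by (intro cSUP_upper bounded_imp_bdd_above compact_imp_bounded
        compact_continuous_image) auto
  also have "\<dots> \<le> Max (range (\<lambda>i. SUP y\<in>X i. h i y))"
    by simp
  finally show ?thesis .
qed

text \<open>A convex function on the whole line is continuous, so its supremum over the compact
  \<open>X i\<close> is a genuine upper bound.\<close>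

lemma abs_constraint_le_const_L:
  assumes "problem_data f g X A0 A" and "y \<in> X i"
  shows "\<bar>g i y\<bar> \<le> const_L g X"
proof -
  have "continuous_on UNIV (g i)"
    using assms(1) by (intro convex_on_continuous) (auto simp: problem_data_def)
  then have "continuous_on (X i) (\<lambda>y. \<bar>g i y\<bar>)"
    by (intro continuous_intros) (auto intro: continuous_on_subset)
  then show ?thesis
    using assms unfolding const_L_def by (intro le_Max_SUP) (auto simp: problem_data_def)
qed

lemma norm_lmi_block_le_const_Q:
  fixes X :: "'n::finite \<Rightarrow> real set"
  assumes "problem_data f g X A0 A" and "y \<in> X i"
  shows "norm ((1 / real CARD('n)) *\<^sub>R A0 + y *\<^sub>R A i) \<le> const_Q X A0 A"
proof -
  have "norm (- ((1 / real CARD('n)) *\<^sub>R A0) - y *\<^sub>R A i) \<le> const_Q X A0 A"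
    using assms unfolding const_Q_def
    by (intro le_Max_SUP continuous_intros) (auto simp: problem_data_def)
  moreover have "- ((1 / real CARD('n)) *\<^sub>R A0) - y *\<^sub>R A i
      = - ((1 / real CARD('n)) *\<^sub>R A0 + y *\<^sub>R A i)"
    by simp
  ultimately show ?thesis
    by (metis norm_minus_cancel)
qed

text \<open>For \<open>\<nu>\<close> below 1 powers decrease in the exponent, and raising
  \<open>\<nu>\<close> to ln (a / b) / ln \<nu> returns a / b.\<close>

lemma power_le_of_log_le:
  fixes \<nu> \<delta> a b :: real
  assumes "0 < \<nu>" "\<nu> < 1" "0 < a" "0 < b" and "(ln a - ln b) / ln \<nu> + \<delta> \<le> real \<phi>"
  shows "\<nu> ^ \<phi> \<le> \<nu> powr \<delta> * a / b"
proof -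
  have "ln \<nu> < 0"
    using assms by simp
  have "\<nu> ^ \<phi> = \<nu> powr real \<phi>"
    using assms by (simp add: powr_realpow)
  also have "\<dots> \<le> \<nu> powr ((ln a - ln b) / ln \<nu> + \<delta>)"
    using assms by (intro powr_mono') auto
  also have "\<dots> = \<nu> powr \<delta> * a / b"
    using assms \<open>ln \<nu> < 0\<close> by (simp add: powr_add) (simp add: powr_def exp_diff)
  finally show ?thesis .
qed

theorem theorem5p1:
  fixes f g :: "'n::finite \<Rightarrow> real \<Rightarrow> real" and X :: "'n \<Rightarrow> real set"
    and A0 :: "real^'d::finite^'d" and A :: "'n \<Rightarrow> real^'d^'d"
    and N :: "'n \<Rightarrow> 'n set" and W :: "real^'n^'n"
    and \<nu> \<alpha> \<beta>0 \<delta> L Q M p :: real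
  assumes "problem_data f g X A0 A"
    and "existence_assumption f g X A0 A"
    and "\<exists>x. slater_vector g X A0 A x"
    and "undirected_graph N"
    and "0 < \<nu>" and "\<nu> < 1" and "consensus_matrix N \<nu> W"
    and "0 < \<alpha>"
    and "L = const_L g X" and "Q = const_Q X A0 A"
    and "M = L + Q" and "0 < M"
    and "0 < \<beta>0"
    and "0 \<le> \<delta>"
    and "p = \<nu> powr \<delta> * \<beta>0 / (\<beta>0 + \<alpha> * M)"
  shows "\<exists>\<phi>bar::real.
    (\<forall>\<phi> xbar \<mu>t Gt r \<mu> G xt c0.
      coba_dd f g X A0 A W \<alpha> \<phi> xbar \<mu>t Gt r \<mu> G xt
      \<and> bounded (range (\<mu> 0)) \<and> bounded (range (G 0))
      \<and> initial_disagreement_bound g A0 A W \<alpha> \<phi> \<mu> G xt c0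
      \<and> c0 \<le> \<beta>0
      \<and> \<phi>bar + \<delta> \<le> real \<phi>
      \<longrightarrow> (\<forall>k\<ge>1. \<forall>i.
            norm (\<mu> (k + 1) i - node_average (\<mu> (k + 1)))
              \<le> 2 * p ^ (k - 1) * \<nu> powr \<delta> * \<beta>0 + 2 * p * \<alpha> * M * ((1 - p ^ (k - 1)) / (1 - p))
          \<and> norm (G (k + 1) i - node_average (G (k + 1)))
              \<le> 2 * p ^ (k - 1) * \<nu> powr \<delta> * \<beta>0 + 2 * p * \<alpha> * M * ((1 - p ^ (k - 1)) / (1 - p))))
    \<and> \<phi>bar = (ln \<beta>0 - ln (4 * real CARD('n) * (1 + (real CARD('d))^2) * (\<beta>0 + \<alpha> * M))) / ln \<nu>"
proof -
  define K where "K = 4 * real CARD('n) * (1 + (real CARD('d))^2)"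
  define \<phi>bar where "\<phi>bar = (ln \<beta>0 - ln (K * (\<beta>0 + \<alpha> * M))) / ln \<nu>"
  have card: "1 \<le> real CARD('n)"
    by (simp add: Suc_leI)
  then have "4 * real CARD('n) * 1 \<le> K"
    unfolding K_def by (intro mult_left_mono) auto
  \<comment> \<open>The first bound absorbs the factor \<open>CARD('n)\<close> of the row sums; the
    second leads to a positive threshold.\<close>
  with card have K: "real CARD('n) \<le> K" "1 < K"
    by linarith+
  have M: "0 < \<alpha> * M"
    using assms by simp
  have damp: "\<nu> powr \<delta> \<le> 1"
    using assms by (auto intro: powr_le1)
  have p: "p < 1" "p * (\<beta>0 + \<alpha> * M) = \<nu> powr \<delta> * \<beta>0"
  proof -
    have "\<beta>0 + \<alpha> * M > 0"
      using assms(13) M by simp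
    then show "p * (\<beta>0 + \<alpha> * M) = \<nu> powr \<delta> * \<beta>0"
      using assms(15) by simp
    have "\<nu> powr \<delta> * \<beta>0 < \<beta>0 + \<alpha> * M"
      using mult_right_mono[OF damp, of \<beta>0] M assms(13) by linarith
    then show "p < 1"
      using M assms(13,15) by simp
  qed
  have "1 * (\<beta>0 + \<alpha> * M) < K * (\<beta>0 + \<alpha> * M)"
    using K M assms(13) by (intro mult_strict_right_mono) auto
  moreover have "\<beta>0 < 1 * (\<beta>0 + \<alpha> * M)"
    using M by simp
  ultimately have KM: "\<beta>0 < K * (\<beta>0 + \<alpha> * M)" "0 < K * (\<beta>0 + \<alpha> * M)"
    using assms(13) by (meson less_trans)+
  \<comment> \<open>Numerator and denominator are both negative. Positivity forces
    \<open>\<phi>\<close> to be at least 1, as the row sum bound requires.\<close>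
  have "0 < \<phi>bar"
    using KM assms(5,6,13) unfolding \<phi>bar_def by (intro divide_neg_neg) auto
  \<comment> \<open>The Slater vector supplies a point in every \<open>X i\<close>, so
    \<open>L\<close> and \<open>Q\<close> bound actual norms and are nonnegative.\<close>
  have LQ: "L \<le> M" "Q \<le> M"
  proof -
    obtain x where "\<And>i. x $ i \<in> X i"
      using assms(3) by (auto simp: slater_vector_def)
    then have "0 \<le> L" "0 \<le> Q"
      using abs_constraint_le_const_L[OF assms(1)] norm_lmi_block_le_const_Q[OF assms(1)]
      unfolding assms(9,10) by (meson abs_ge_zero norm_ge_zero order_trans)+
    then show "L \<le> M" "Q \<le> M"
      using assms(11) by auto
  qed
  have "norm (\<mu> (Suc k) i - node_average (\<mu> (Suc k)))
        \<le> 2 * (p ^ (k - 1) * (\<nu> powr \<delta> * \<beta>0) + p * (\<alpha> * M) * ((1 - p ^ (k - 1)) / (1 - p)))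
      \<and> norm (G (Suc k) i - node_average (G (Suc k)))
        \<le> 2 * (p ^ (k - 1) * (\<nu> powr \<delta> * \<beta>0) + p * (\<alpha> * M) * ((1 - p ^ (k - 1)) / (1 - p)))"
    if run: "coba_dd f g X A0 A W \<alpha> \<phi> xbar \<mu>t Gt r \<mu> G xt"
      and init: "initial_disagreement_bound g A0 A W \<alpha> \<phi> \<mu> G xt c0" and "c0 \<le> \<beta>0"
      and \<phi>: "\<phi>bar + \<delta> \<le> real \<phi>" and k: "1 \<le> k"
    for \<phi> xbar \<mu>t Gt r \<mu> G xt c0 k i
  proof -
    have xt: "xt k j \<in> X j" for k j
      using run by (auto simp: coba_dd_def is_arg_min_def)
    have ones: "matpow W \<phi> *v (\<chi> i. 1) = (\<chi> i. 1)"
      using assms(7) by (intro matpow_fixed_vector) (simp add: consensus_matrix_def)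
    have "0 < \<phi>"
      using \<phi> \<open>0 < \<phi>bar\<close> \<open>0 \<le> \<delta>\<close> by (cases \<phi>) auto
    \<comment> \<open>The threshold yields \<open>\<nu> ^ \<phi> \<le> p / K\<close>, and
      \<open>K\<close> is at least the number of nodes.\<close>
    have rows: "(\<Sum>j\<in>UNIV. \<bar>(matpow W \<phi> - avg_matrix) $ i $ j\<bar>) \<le> p" for i
    proof -
      have "\<nu> ^ \<phi> \<le> \<nu> powr \<delta> * \<beta>0 / (K * (\<beta>0 + \<alpha> * M))"
        using \<phi> assms(5,6,13) KM unfolding \<phi>bar_def by (intro power_le_of_log_le) auto
      then have "\<nu> ^ \<phi> \<le> p / K"
        by (simp add: assms(15) mult.commute)
      then have "real CARD('n) * \<nu> ^ \<phi> \<le> K * (p / K)"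
        using K assms(5) by (intro mult_mono) auto
      then show ?thesis
        using consensus_row_sum_le[OF assms(7) _ \<open>0 < \<phi>\<close>, of i] assms(5) K by simp
    qed
    have init_mu: "norm (\<Sum>j\<in>UNIV. ((matpow W \<phi> - avg_matrix) $ i $ j) *\<^sub>R mu_step g \<alpha> \<mu> xt 0 j)
        \<le> \<beta>0"
      and init_G: "norm (\<Sum>j\<in>UNIV. ((matpow W \<phi> - avg_matrix) $ i $ j) *\<^sub>R G_step A0 A \<alpha> G xt 0 j)
        \<le> \<beta>0" for i
      using init \<open>c0 \<le> \<beta>0\<close> unfolding initial_disagreement_bound_def real_scaleR_def
      by (meson dual_order.trans le_add_same_cancel1 le_add_same_cancel2 norm_ge_zero)+
    have "norm (mu_step g \<alpha> \<mu> xt k j - \<mu> k j) \<le> \<alpha> * M" for k j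
      using abs_constraint_le_const_L[OF assms(1) xt] LQ assms(8,9)
      by (simp add: mu_step_def abs_mult) (meson order_trans)
    note mu = projected_consensus_agreement[where u = \<mu> and s = "mu_step g \<alpha> \<mu> xt"
        and S = "D_mu (dual_radius f g X A0 A xbar \<mu>t Gt + r)",
        OF _ _ ones rows _ this init_mu p k]
    have "norm (G_step A0 A \<alpha> G xt k j - G k j) \<le> \<alpha> * M" for k j
      using norm_lmi_block_le_const_Q[OF assms(1) xt, of k j] LQ assms(8,10)
      by (simp add: G_step_def)
    note G = projected_consensus_agreement[where u = G and s = "G_step A0 A \<alpha> G xt"
        and S = "D_G (dual_radius f g X A0 A xbar \<mu>t Gt + r)",
        OF convex_D_G closed_D_G ones rows _ this init_G p k]
    show ?thesis
      \<comment> \<open>What remains are the update equations contained in \<open>coba_dd\<close>,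
        and convexity and closedness of the interval \<open>D_mu\<close>.\<close>
      using run by (intro conjI mu G) (auto simp: coba_dd_def D_mu_eq)
  qed
  then show ?thesis
    by (intro exI[of _ \<phi>bar]) (auto simp: \<phi>bar_def K_def algebra_simps)
qed

end
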